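(* Let $Y_1,Y_2,\ldots$ be i.i.d. real random variables with the common distribution of a random variable $Y$ such that $\mathbb{P}(Y>0)>0$ and the moment generating function $m(\lambda)=\mathbb{E}e^{\lambda Y}$ exists (is finite) in some neighbourhood of $\lambda=1$, and suppose that $m(1)=\mathbb{E}e^{Y}=1$. Let $\{W_n\}$ be the CUSUM process generated by $Y_1,Y_2,\ldots$. Then there exists a positive constant $a>0$ such that $$\lim_{n\to\infty}\frac{\mathbb{E}e^{W_n}}{n}=a.$$
   Context: The CUSUM process based on $Y_1,Y_2,\ldots$ is defined by $W_0=0$ and $W_{n+1}=\max\{W_n+Y_{n+1},0\}$. *)

theory Defs
  imports "HOL-Probability.Probability"
begin

definition mgf :: "'a measure \<Rightarrow> ('a \<Rightarrow> real) \<Rightarrow> real \<Rightarrow> real" where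
  "mgf M X t = (\<integral>\<omega>. exp (t * X \<omega>) \<partial>M)"

(* The Bochner integral in mgf is 0 by convention when the expectation is infinite;
   existence of the moment generating function at t has to be stated separately. *)
definition mgf_exists :: "'a measure \<Rightarrow> ('a \<Rightarrow> real) \<Rightarrow> real \<Rightarrow> bool" where
  "mgf_exists M X t \<longleftrightarrow> integrable M (\<lambda>\<omega>. exp (t * X \<omega>))"

(* The increments are Y 1, Y 2, ...; the value Y 0 is never used. *)
primrec cusum :: "(nat \<Rightarrow> 'a \<Rightarrow> real) \<Rightarrow> nat \<Rightarrow> 'a \<Rightarrow> real" where
  "cusum Y 0 \<omega> = 0"
| "cusum Y (Suc n) \<omega> = max (cusum Y n \<omega> + Y (Suc n) \<omega>) 0"

end

theory Submission
  imports Defs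
begin

text \<open>
  Write \<open>A\<^sub>n = E exp W\<^sub>n\<close>. From \<open>exp (max x 0) = exp x + max 0 (1 - exp x)\<close> and \<open>E exp Y = 1\<close> one gets
  \<open>A\<^bsub>n+1\<^esub> - A\<^sub>n = d\<^sub>n\<close> with \<open>d\<^sub>n = E max 0 (1 - exp (W\<^sub>n + Y\<^bsub>n+1\<^esub>))\<close>. Since \<open>W\<^sub>n\<close> is stochastically increasing
  in \<open>n\<close>, the sequence \<open>d\<^sub>n\<close> is decreasing, so \<open>A\<^sub>n / n\<close> converges to the limit of \<open>d\<^sub>n\<close> by Cesaro averaging.
  The limit is positive because the same identity at exponent 1/2, with \<open>\<rho> = E exp (Y/2) < 1\<close>,
  gives \<open>d\<^sub>n \<ge> B\<^bsub>n+1\<^esub> - \<rho> B\<^sub>n \<ge> (1 - \<rho>) B\<^sub>n \<ge> 1 - \<rho>\<close> for \<open>B\<^sub>n = E exp (W\<^sub>n/2)\<close>.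
\<close>

section \<open>Cesaro averaging and inequalities for the exponential\<close>

lemma LIMSEQ_over_n_of_diff:
  fixes A :: "nat \<Rightarrow> real"
  assumes "(\<lambda>n. A (Suc n) - A n) \<longlonglongrightarrow> a"
  shows "(\<lambda>n. A n / real n) \<longlonglongrightarrow> a"
proof (rule LIMSEQ_I)
  fix e :: real assume e: "0 < e"
  obtain K where K: "\<And>n. n \<ge> K \<Longrightarrow> \<bar>A (Suc n) - A n - a\<bar> < e / 2"
    using LIMSEQ_D[OF assms, of "e / 2"] e by auto
  define c where "c = \<bar>A K - real K * a\<bar>"
  \<comment> \<open>Beyond \<open>K\<close> each increment differs from \<open>a\<close> by less
    than \<open>e / 2\<close>, so the distance of \<open>A n\<close> from the line of slope
    \<open>a\<close> grows by at most \<open>e / 2\<close> per step; \<open>c\<close> is its value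
    at \<open>K\<close>.\<close>
  have bound: "\<bar>A n - real n * a\<bar> \<le> c + real (n - K) * (e / 2)" if "n \<ge> K" for n
    using that
  proof (induction n rule: dec_induct)
    case base
    then show ?case by (simp add: c_def)
  next
    case (step n)
    have "A (Suc n) - real (Suc n) * a = (A n - real n * a) + (A (Suc n) - A n - a)"
      by (simp add: algebra_simps)
    moreover have "real (Suc n - K) * (e / 2) = real (n - K) * (e / 2) + e / 2"
      using step.hyps by (simp add: Suc_diff_le distrib_right add_divide_distrib del: of_nat_diff)
    ultimately show ?case
      using step.IH K[of n] step.hyps by linarith
  qed
  \<comment> \<open>From \<open>L\<close> on, \<open>c\<close> costs less than
    \<open>n * (e / 2)\<close>; the accumulated increments use up the other half of
    \<open>e\<close>.\<close>
  obtain L :: nat where L: "real L > 2 * c / e"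
    using reals_Archimedean2 by blast
  show "\<exists>no. \<forall>n\<ge>no. norm (A n / real n - a) < e"
  proof (intro exI allI impI)
    fix n assume n: "n \<ge> max (max K L) 1"
    have "2 * c / e < real n" using L n by linarith
    then have "c < real n * (e / 2)" using e by (simp add: field_simps)
    moreover have "real (n - K) * (e / 2) \<le> real n * (e / 2)"
      using e by (intro mult_right_mono) auto
    ultimately have "\<bar>A n - real n * a\<bar> < real n * e"
      using bound[of n] n by (simp add: field_simps)
    moreover have "A n / real n - a = (A n - real n * a) / real n"
      using n by (simp add: field_simps)
    ultimately show "norm (A n / real n - a) < e"
      using n by (simp add: field_simps)
  qed
qed

text \<open>For \<open>x \<ge> 0\<close> the last term vanishes; for \<open>x \<le> 0\<close> both
  sides equal 1.\<close>

lemma exp_max_0: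
  fixes c x :: real
  assumes "c \<ge> 0"
  shows "exp (c * max x 0) = exp (c * x) + max 0 (1 - exp (c * x))"
  using assms by (cases "x \<le> 0") (auto simp: max_def mult_le_0_iff zero_le_mult_iff)

text \<open>AM-GM for 1 and \<open>exp y\<close>: the difference of the two sides is half the square
  of \<open>1 - exp (y / 2)\<close>, which is zero only at \<open>y = 0\<close>.\<close>

lemma exp_half_le:
  fixes y :: real
  shows "exp (y / 2) \<le> (1 + exp y) / 2"
    and "y \<noteq> 0 \<Longrightarrow> exp (y / 2) < (1 + exp y) / 2"
proof -
  have sq: "(1 - exp (y / 2))\<^sup>2 = 1 - 2 * exp (y / 2) + exp y"
    by (simp add: power2_diff flip: exp_of_nat_mult)
  show "exp (y / 2) \<le> (1 + exp y) / 2"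
    using sq zero_le_power2[of "1 - exp (y / 2)"] by argo
  assume "y \<noteq> 0"
  then have "(1 - exp (y / 2))\<^sup>2 > 0" by simp
  then show "exp (y / 2) < (1 + exp y) / 2"
    using sq by argo
qed

text \<open>Integrating the AM-GM bound gives at most (1 + 1) / 2. The inequality is strict on the
  event \<open>X > 0\<close>, which has positive probability.\<close>

lemma (in prob_space) expectation_exp_half:
  fixes X :: "'a \<Rightarrow> real"
  assumes X: "X \<in> borel_measurable M"
    and int: "integrable M (\<lambda>\<omega>. exp (X \<omega>))" and one: "(\<integral>\<omega>. exp (X \<omega>) \<partial>M) = 1"
    and pos: "prob {\<omega> \<in> space M. X \<omega> > 0} > 0"
  shows integrable_exp_half: "integrable M (\<lambda>\<omega>. exp (X \<omega> / 2))"
    and expectation_exp_half_less_1: "(\<integral>\<omega>. exp (X \<omega> / 2) \<partial>M) < 1"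
proof -
  have int2: "integrable M (\<lambda>\<omega>. (1 + exp (X \<omega>)) / 2)"
    using int by simp
  show int1: "integrable M (\<lambda>\<omega>. exp (X \<omega> / 2))"
    by (rule Bochner_Integration.integrable_bound[OF int2])
       (use X exp_half_le(1) in \<open>auto intro!: AE_I2 order.trans[OF _ abs_ge_self]\<close>)
  have "(\<integral>\<omega>. exp (X \<omega> / 2) \<partial>M) < (\<integral>\<omega>. (1 + exp (X \<omega>)) / 2 \<partial>M)"
  proof (rule integral_less_AE[OF int1 int2, where A = "{\<omega> \<in> space M. X \<omega> > 0}"])
    show "emeasure M {\<omega> \<in> space M. X \<omega> > 0} \<noteq> 0"
      using pos by (simp add: emeasure_eq_measure)
    show "{\<omega> \<in> space M. X \<omega> > 0} \<in> sets M"
      using X by measurable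
    show "AE \<omega> in M. \<omega> \<in> {\<omega> \<in> space M. X \<omega> > 0} \<longrightarrow> exp (X \<omega> / 2) \<noteq> (1 + exp (X \<omega>)) / 2"
      using exp_half_le(2) by (intro AE_I2) (metis less_irrefl mem_Collect_eq)
    show "AE \<omega> in M. exp (X \<omega> / 2) \<le> (1 + exp (X \<omega>)) / 2"
      using exp_half_le(1) by (intro AE_I2)
  qed
  also have "\<dots> = 1"
    using int one by (simp add: prob_space)
  finally show "(\<integral>\<omega>. exp (X \<omega> / 2) \<partial>M) < 1" .
qed

section \<open>CUSUM as a function of finitely many coordinates\<close>

lemma cusum_nonneg: "cusum Y n \<omega> \<ge> 0"
  by (cases n) auto

text \<open>Writes the CUSUM value as a fixed function of the increments indexed by
  \<open>I\<close>, the form in which independence of disjoint blocks applies to it.\<close>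

lemma cusum_restrict:
  "{1..n} \<subseteq> I \<Longrightarrow> cusum (\<lambda>i s. s i) n (restrict (\<lambda>i. Y i \<omega>) I) = cusum Y n \<omega>"
  by (induction n) (auto simp: subset_iff)

lemma measurable_cusum_PiM:
  assumes "{1..n} \<subseteq> I"
  shows "cusum (\<lambda>i s. s i) n \<in> borel_measurable (PiM I (\<lambda>_. borel))"
  using assms
proof (induction n)
  case 0
  have "cusum (\<lambda>i s. s i) 0 = (\<lambda>_. 0)" by auto
  then show ?case by simp
next
  case (Suc n)
  have [measurable]: "cusum (\<lambda>i s. s i) n \<in> borel_measurable (PiM I (\<lambda>_. borel))"
    and [simp]: "Suc n \<in> I"
    using Suc by (auto simp: subset_iff)
  have "cusum (\<lambda>i s. s i) (Suc n) = (\<lambda>s. max (cusum (\<lambda>i s. s i) n s + s (Suc n)) 0)"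
    by auto
  then show ?case by simp
qed

section \<open>The i.i.d. model and stochastic monotonicity\<close>

locale iid_increments = prob_space M for M :: "'a measure" +
  fixes Y :: "nat \<Rightarrow> 'a \<Rightarrow> real" and N :: "real measure"
  assumes indep: "indep_vars (\<lambda>_. borel) Y {1..}"
    and distr_Y: "\<And>n. n \<ge> 1 \<Longrightarrow> distr M borel (Y n) = N"
begin

abbreviation "W \<equiv> cusum Y"

lemma measurable_Y [measurable]: "Y (Suc n) \<in> borel_measurable M"
  using indep by (auto simp: indep_vars_def)

lemma measurable_W [measurable]: "W n \<in> borel_measurable M"
  by (induction n) simp_all

lemma sets_N [measurable_cong]: "sets N = sets borel"
  using distr_Y[of 1] by auto

lemma prob_space_N: "prob_space N"
  using prob_space_distr[OF measurable_Y[of 0]] distr_Y[of 1] by simp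

sublocale N: prob_space N by (rule prob_space_N)

text \<open>\<open>W n\<close> depends only on the block \<open>{1..n}\<close>, which is disjoint
  from \<open>{Suc n}\<close>.\<close>

lemma indep_W_Y: "indep_var borel (W n) borel (Y (Suc n))"
proof -
  have "indep_var (PiM {1..n} (\<lambda>_. borel)) (\<lambda>\<omega>. restrict (\<lambda>i. Y i \<omega>) {1..n})
      (PiM {Suc n} (\<lambda>_. borel)) (\<lambda>\<omega>. restrict (\<lambda>i. Y i \<omega>) {Suc n})"
    by (rule indep_var_restrict[OF indep]) auto
  then have "indep_var borel (cusum (\<lambda>i s. s i) n \<circ> (\<lambda>\<omega>. restrict (\<lambda>i. Y i \<omega>) {1..n}))
      borel ((\<lambda>s. s (Suc n)) \<circ> (\<lambda>\<omega>. restrict (\<lambda>i. Y i \<omega>) {Suc n}))"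
    by (rule indep_var_compose) (auto intro: measurable_cusum_PiM)
  then show ?thesis
    by (simp add: comp_def cusum_restrict)
qed

text \<open>By independence the joint law is a product, and Tonelli applies; values in
  \<open>ennreal\<close> spare any integrability condition.\<close>

lemma nn_integral_step:
  fixes h :: "real \<Rightarrow> ennreal"
  assumes [measurable]: "h \<in> borel_measurable borel"
  shows "(\<integral>\<^sup>+\<omega>. h (W n \<omega> + Y (Suc n) \<omega>) \<partial>M) = (\<integral>\<^sup>+\<omega>. \<integral>\<^sup>+y. h (W n \<omega> + y) \<partial>N \<partial>M)"
proof -
  have "(\<integral>\<^sup>+\<omega>. h (W n \<omega> + Y (Suc n) \<omega>) \<partial>M)
      = (\<integral>\<^sup>+z. h (fst z + snd z) \<partial>distr M (borel \<Otimes>\<^sub>M borel) (\<lambda>\<omega>. (W n \<omega>, Y (Suc n) \<omega>)))"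
    by (simp add: nn_integral_distr)
  also have "\<dots> = (\<integral>\<^sup>+z. h (fst z + snd z) \<partial>(distr M borel (W n) \<Otimes>\<^sub>M N))"
    using indep_W_Y[of n] distr_Y[of "Suc n"] by (simp add: indep_var_distribution_eq)
  also have "\<dots> = (\<integral>\<^sup>+w. \<integral>\<^sup>+y. h (w + y) \<partial>N \<partial>distr M borel (W n))"
    by (subst N.nn_integral_fst[symmetric]) (simp_all, measurable)
  also have "\<dots> = (\<integral>\<^sup>+\<omega>. \<integral>\<^sup>+y. h (W n \<omega> + y) \<partial>N \<partial>M)"
    by (subst nn_integral_distr) measurable
  finally show ?thesis .
qed

text \<open>Stochastic order, tested on monotone \<open>G\<close>. The start is
  \<open>W 0 = 0 \<le> W 1\<close>; integrating out the last increment then reduces each step to the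
  previous one, with another monotone test function, hence the induction over arbitrary
  \<open>G\<close>.\<close>

lemma nn_integral_W_mono:
  fixes G :: "real \<Rightarrow> ennreal"
  assumes "G \<in> borel_measurable borel" "mono G"
  shows "(\<integral>\<^sup>+\<omega>. G (W n \<omega>) \<partial>M) \<le> (\<integral>\<^sup>+\<omega>. G (W (Suc n) \<omega>) \<partial>M)"
  using assms
proof (induction n arbitrary: G)
  case 0
  then show ?case
    by (intro nn_integral_mono) (auto simp: mono_def)
next
  case (Suc n)
  note [measurable] = Suc.prems(1)
  \<comment> \<open>The one-step transition operator of the chain \<open>W\<close> applied to
    \<open>G\<close>.\<close>
  define H where "H w = (\<integral>\<^sup>+y. G (max (w + y) 0) \<partial>N)" for w
  have "H \<in> borel_measurable borel"
    unfolding H_def by measurable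
  moreover have "mono H"
    unfolding H_def using Suc.prems(2)
    by (intro monoI nn_integral_mono) (auto simp: mono_def max_def)
  moreover have "(\<integral>\<^sup>+\<omega>. G (W (Suc k) \<omega>) \<partial>M) = (\<integral>\<^sup>+\<omega>. H (W k \<omega>) \<partial>M)" for k
    unfolding H_def using nn_integral_step[of "\<lambda>x. G (max x 0)" k] by simp
  ultimately show ?case
    using Suc.IH[of H] by (simp only:)
qed

lemma nn_integral_step_mono:
  fixes h :: "real \<Rightarrow> ennreal"
  assumes [measurable]: "h \<in> borel_measurable borel" and "mono h"
  shows "(\<integral>\<^sup>+\<omega>. h (W n \<omega> + Y (Suc n) \<omega>) \<partial>M)
    \<le> (\<integral>\<^sup>+\<omega>. h (W (Suc n) \<omega> + Y (Suc (Suc n)) \<omega>) \<partial>M)"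
  unfolding nn_integral_step[OF assms(1)]
proof (rule nn_integral_W_mono)
  show "(\<lambda>w. \<integral>\<^sup>+y. h (w + y) \<partial>N) \<in> borel_measurable borel"
    by measurable
  show "mono (\<lambda>w. \<integral>\<^sup>+y. h (w + y) \<partial>N)"
    using assms(2) by (intro monoI nn_integral_mono) (auto simp: mono_def)
qed

section \<open>Expected gain from truncation at 0 and the moment recursion\<close>

definition deficit :: "real \<Rightarrow> nat \<Rightarrow> real" where
  "deficit c n = (\<integral>\<omega>. max 0 (1 - exp (c * (W n \<omega> + Y (Suc n) \<omega>))) \<partial>M)"

lemma integrable_deficit:
  "integrable M (\<lambda>\<omega>. max 0 (1 - exp (c * (W n \<omega> + Y (Suc n) \<omega>))))"
  by (rule integrable_const_bound[where B = 1]) auto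

text \<open>The integrand is 1 minus \<open>min 1 (exp x)\<close>, a bounded increasing function of
  \<open>x\<close>, so stochastic monotonicity of the value before truncation applies.\<close>

lemma deficit_decseq: "decseq (deficit 1)"
proof (rule decseq_SucI)
  fix n
  define X where "X k \<omega> = W k \<omega> + Y (Suc k) \<omega>" for k \<omega>
  have [measurable]: "X k \<in> borel_measurable M" for k
    unfolding X_def by measurable
  have int: "integrable M (\<lambda>\<omega>. min 1 (exp (X k \<omega>)))" for k
    by (rule integrable_const_bound[where B = 1]) auto
  have "deficit 1 k = (\<integral>\<omega>. 1 - min 1 (exp (X k \<omega>)) \<partial>M)" for k
    unfolding deficit_def X_def by (intro Bochner_Integration.integral_cong) auto
  then have eq: "deficit 1 k = 1 - (\<integral>\<omega>. min 1 (exp (X k \<omega>)) \<partial>M)" for k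
    using int by (simp add: prob_space)
  have "ennreal (\<integral>\<omega>. min 1 (exp (X n \<omega>)) \<partial>M) \<le> ennreal (\<integral>\<omega>. min 1 (exp (X (Suc n) \<omega>)) \<partial>M)"
    using nn_integral_step_mono[of "\<lambda>x. ennreal (min 1 (exp x))" n]
    by (simp add: nn_integral_eq_integral[OF int] mono_def ennreal_leI min_le_iff_disj
        flip: X_def del: cusum.simps)
  then have "(\<integral>\<omega>. min 1 (exp (X n \<omega>)) \<partial>M) \<le> (\<integral>\<omega>. min 1 (exp (X (Suc n) \<omega>)) \<partial>M)"
    by (subst (asm) ennreal_le_iff) (auto intro: integral_nonneg)
  then show "deficit 1 (Suc n) \<le> deficit 1 n"
    by (simp add: eq)
qed

text \<open>Where the exponent is nonpositive, halving it increases the exponential; elsewhere both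
  integrands are 0.\<close>

lemma deficit_half_le: "deficit (1 / 2) n \<le> deficit 1 n"
  unfolding deficit_def
proof (rule integral_mono[OF integrable_deficit integrable_deficit])
  fix \<omega>
  show "max 0 (1 - exp (1 / 2 * (W n \<omega> + Y (Suc n) \<omega>)))
      \<le> max 0 (1 - exp (1 * (W n \<omega> + Y (Suc n) \<omega>)))"
    by (cases "W n \<omega> + Y (Suc n) \<omega> \<le> 0") auto
qed

text \<open>Independence factors the moment of the untruncated value, and \<open>exp_max_0\<close>
  adds the gain from truncation. That gain is at most 1, so integrability passes from
  \<open>n\<close> to \<open>Suc n\<close>.\<close>

lemma
  assumes c: "c \<ge> 0" and int: "integrable N (\<lambda>y. exp (c * y))"
  shows integrable_exp_W: "integrable M (\<lambda>\<omega>. exp (c * W n \<omega>))"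
    and expectation_exp_W_Suc: "(\<integral>\<omega>. exp (c * W (Suc n) \<omega>) \<partial>M)
      = (\<integral>\<omega>. exp (c * W n \<omega>) \<partial>M) * (\<integral>y. exp (c * y) \<partial>N) + deficit c n"
proof -
  have indep': "indep_var borel (\<lambda>\<omega>. exp (c * W n \<omega>)) borel (\<lambda>\<omega>. exp (c * Y (Suc n) \<omega>))" for n
    using indep_var_compose[OF indep_W_Y, of "\<lambda>x. exp (c * x)" borel "\<lambda>x. exp (c * x)" borel n]
    by (simp add: comp_def)
  have Y_int: "integrable M (\<lambda>\<omega>. exp (c * Y (Suc n) \<omega>))" for n
    using int unfolding distr_Y[of "Suc n", symmetric, simplified]
    by (simp add: integrable_distr_eq)
  have Y_eq: "(\<integral>\<omega>. exp (c * Y (Suc n) \<omega>) \<partial>M) = (\<integral>y. exp (c * y) \<partial>N)" for n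
    unfolding distr_Y[of "Suc n", symmetric, simplified] by (simp add: integral_distr)
  have W_Suc: "exp (c * W (Suc n) \<omega>) = exp (c * W n \<omega>) * exp (c * Y (Suc n) \<omega>)
      + max 0 (1 - exp (c * (W n \<omega> + Y (Suc n) \<omega>)))" for n \<omega>
    using exp_max_0[OF c, of "W n \<omega> + Y (Suc n) \<omega>"] by (simp add: distrib_left exp_add)
  have W_int: "integrable M (\<lambda>\<omega>. exp (c * W n \<omega>))" for n
  proof (induction n)
    case (Suc n)
    then show ?case
      unfolding W_Suc
      by (intro Bochner_Integration.integrable_add indep_var_integrable[OF indep'] Y_int integrable_deficit)
  qed simp
  show "integrable M (\<lambda>\<omega>. exp (c * W n \<omega>))" by (fact W_int)
  show "(\<integral>\<omega>. exp (c * W (Suc n) \<omega>) \<partial>M)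
      = (\<integral>\<omega>. exp (c * W n \<omega>) \<partial>M) * (\<integral>y. exp (c * y) \<partial>N) + deficit c n"
    unfolding W_Suc deficit_def
    by (subst Bochner_Integration.integral_add)
       (simp_all only: indep_var_integrable[OF indep' W_int Y_int] integrable_deficit
         indep_var_lebesgue_integral[OF indep' W_int Y_int] Y_eq)
qed

lemma expectation_exp_W_mono:
  assumes c: "c \<ge> 0" and int: "integrable N (\<lambda>y. exp (c * y))"
  shows "(\<integral>\<omega>. exp (c * W n \<omega>) \<partial>M) \<le> (\<integral>\<omega>. exp (c * W (Suc n) \<omega>) \<partial>M)"
proof -
  have "ennreal (\<integral>\<omega>. exp (c * W n \<omega>) \<partial>M) \<le> ennreal (\<integral>\<omega>. exp (c * W (Suc n) \<omega>) \<partial>M)"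
    using nn_integral_W_mono[of "\<lambda>w. ennreal (exp (c * w))" n] c
    by (simp add: nn_integral_eq_integral[OF integrable_exp_W[OF assms]] mono_def ennreal_leI
        mult_left_mono del: cusum.simps)
  then show ?thesis
    by (subst (asm) ennreal_le_iff) (auto intro: integral_nonneg)
qed

lemma expectation_exp_W_ge_1:
  assumes "c \<ge> 0" "integrable N (\<lambda>y. exp (c * y))"
  shows "1 \<le> (\<integral>\<omega>. exp (c * W n \<omega>) \<partial>M)"
  using assms
  by (intro integral_ge_const integrable_exp_W) (auto simp: cusum_nonneg)

text \<open>At exponent 1/2 the recursion has a factor below 1, so a moment that never decreases
  needs a gain of at least \<open>1 - \<rho>\<close> per step to make up the loss.\<close>

lemma deficit_lower_bound:
  assumes int: "integrable N (\<lambda>y. exp (y / 2))" and less: "(\<integral>y. exp (y / 2) \<partial>N) < 1"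
  shows "1 - (\<integral>y. exp (y / 2) \<partial>N) \<le> deficit 1 n"
proof -
  define B where "B n = (\<integral>\<omega>. exp (1 / 2 * W n \<omega>) \<partial>M)" for n
  define \<rho> where "\<rho> = (\<integral>y. exp (y / 2) \<partial>N)"
  have int': "integrable N (\<lambda>y. exp (1 / 2 * y))"
    using int by simp
  have "1 - \<rho> \<le> (1 - \<rho>) * B n"
    using expectation_exp_W_ge_1[OF _ int', of n] less by (simp add: B_def \<rho>_def)
  also have "\<dots> \<le> B (Suc n) - B n * \<rho>"
    using expectation_exp_W_mono[OF _ int', of n] by (simp add: B_def algebra_simps)
  also have "\<dots> = deficit (1 / 2) n"
    using expectation_exp_W_Suc[OF _ int', of n] by (simp add: B_def \<rho>_def del: cusum.simps)
  finally show ?thesis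
    using deficit_half_le[of n] by (simp add: \<rho>_def)
qed

section \<open>Linear growth of the expectation\<close>

theorem expectation_exp_W_linear:
  assumes int: "integrable N exp" and one: "(\<integral>y. exp y \<partial>N) = 1"
    and pos: "measure N {0<..} > 0"
  shows "\<exists>a>0. (\<lambda>n. (\<integral>\<omega>. exp (W n \<omega>) \<partial>M) / real n) \<longlonglongrightarrow> a"
proof -
  define \<rho> where "\<rho> = (\<integral>y. exp (y / 2) \<partial>N)"
  have space_N: "space N = UNIV"
    using sets_eq_imp_space_eq[OF sets_N] by simp
  have "{0<..} = {y \<in> space N. y > 0}"
    by (auto simp: space_N)
  then have half: "integrable N (\<lambda>y. exp (y / 2))" "\<rho> < 1"
    using N.expectation_exp_half[of "\<lambda>y. y"] int one pos
    unfolding \<rho>_def by (simp_all add: measurable_cong_sets[OF sets_N])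
  have lower: "1 - \<rho> \<le> deficit 1 n" for n
    using deficit_lower_bound half by (simp add: \<rho>_def)
  obtain a where a: "deficit 1 \<longlonglongrightarrow> a"
    using decseq_convergent[OF deficit_decseq] lower by blast
  \<comment> \<open>The lower bound is uniform in \<open>n\<close>, so it survives in the limit and
    keeps \<open>a\<close> positive.\<close>
  have "1 - \<rho> \<le> a"
    using a lower by (intro LIMSEQ_le_const) auto
  moreover have "(\<integral>\<omega>. exp (W (Suc n) \<omega>) \<partial>M) - (\<integral>\<omega>. exp (W n \<omega>) \<partial>M) = deficit 1 n" for n
    using expectation_exp_W_Suc[of 1 n] int one by (simp del: cusum.simps)
  then have "(\<lambda>n. (\<integral>\<omega>. exp (W n \<omega>) \<partial>M) / real n) \<longlonglongrightarrow> a"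
    using a by (intro LIMSEQ_over_n_of_diff) simp
  ultimately show ?thesis
    using half(2) by (intro exI[of _ a]) simp
qed

end

theorem corollary5p1:
  fixes M :: "'a measure"
    and Y :: "nat \<Rightarrow> 'a \<Rightarrow> real"
    and Y' :: "'a \<Rightarrow> real"
  assumes "prob_space M"
    and "prob_space.indep_vars M (\<lambda>_. borel) Y {1..}"
    and "Y' \<in> borel_measurable M"
    and "\<And>n. n \<ge> 1 \<Longrightarrow> distr M borel (Y n) = distr M borel Y'"
    and "measure M {\<omega> \<in> space M. Y' \<omega> > 0} > 0"
    and "\<forall>\<^sub>F t in nhds 1. mgf_exists M Y' t"
    and "mgf M Y' 1 = 1"
  shows "\<exists>a::real. a > 0 \<and> (\<lambda>n. (\<integral>\<omega>. exp (cusum Y n \<omega>) \<partial>M) / real n) \<longlonglongrightarrow> a"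
proof -
  interpret iid_increments M Y "distr M borel Y'"
    by (intro iid_increments.intro iid_increments_axioms.intro assms)
  note [measurable] = assms(3)
  \<comment> \<open>The filter \<open>nhds 1\<close>, unlike \<open>at 1\<close>, includes the point
    1 itself.\<close>
  have "mgf_exists M Y' 1"
    using assms(6) by (rule eventually_nhds_x_imp_x)
  then have "integrable (distr M borel Y') exp"
    by (simp add: mgf_exists_def integrable_distr_eq)
  moreover have "(\<integral>y. exp y \<partial>distr M borel Y') = 1"
    using assms(7) by (simp add: mgf_def integral_distr)
  moreover have "Y' -` {0<..} \<inter> space M = {\<omega> \<in> space M. Y' \<omega> > 0}"
    by auto
  then have "measure (distr M borel Y') {0<..} > 0"
    using assms(5) by (simp add: measure_distr)
  ultimately show ?thesis
    by (rule expectation_exp_W_linear)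
qed

end
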